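(* Let $X$ and $Y$ be independent real-valued centered Gaussian random variables, each with positive variance. Then for all $r\in\mathbb{N}$ and $n,m\in\mathbb{N}\cup\{0\}$, $$\mathbf{E}\left[X^{2m}Y^{2n}(X^2-Y^2)^{2r}\right]\geq \binom{(m\wedge n)+r}{r}_{\frac12}\,\mathbf{E}[X^{2m}]\,\mathbf{E}[Y^{2n}]\left(\mathbf{E}\left[(X+Y)^{2r}\right]\right)^2.$$ Equality holds if and only if $m=n$ and $\mathbf{E}[X^2]=\mathbf{E}[Y^2]$.
   Context: $\mathbb{N}=\{1,2,3,\dots\}$, $m\wedge n=\min\{m,n\}$, and $\mathbf{E}$ denotes expectation; a zeroth power equals $1$. For real $\alpha\neq 0$, $(\alpha)_0=1$ and $(\alpha)_k=\alpha(\alpha+1)\cdots(\alpha+k-1)$ for $k\geq 1$. For integers $0\le k\le n$, $$\binom{n}{k}_{\frac12}:=\frac{\left(\frac12\right)_n}{\left(\frac12\right)_{n-k}\left(\frac12\right)_k}=\frac{(2n-1)!!}{(2n-2k-1)!!\,(2k-1)!!},$$ with the convention $(-1)!!=1$. *)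

theory Defs
  imports "HOL-Probability.Probability"
begin

(* Meant for k \<le> n only, because of the truncated subtraction. *)
definition half_binomial :: "nat \<Rightarrow> nat \<Rightarrow> real" where
  "half_binomial n k =
     pochhammer (1/2) n / (pochhammer (1/2) (n - k) * pochhammer (1/2) k)"

end

theory Submission
  imports Defs "HOL-Computational_Algebra.Polynomial"
begin

text \<open>
  Assume \<open>m \<le> n\<close> and put \<open>\<alpha> = m + 1/2\<close>, \<open>\<beta> = n + 1/2\<close>. Weighting by \<open>X\<^sup>2\<^sup>m Y\<^sup>2\<^sup>n\<close> turns \<open>X\<^sup>2\<close> and \<open>Y\<^sup>2\<close>
  into independent scaled gamma variables of shapes \<open>\<alpha>\<close> and \<open>\<beta>\<close>. Their total is independent
  of their ratio, so the claim becomes the lower bound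
  \<open>E (B - c)\<^sup>2\<^sup>r \<ge> (1/2)\<^sub>r (\<alpha>)\<^sub>r / (\<alpha> + \<beta>)\<^sub>2\<^sub>r\<close> for a Beta\<open>(\<alpha>,\<beta>)\<close> variable \<open>B\<close> and
  \<open>c = E Y\<^sup>2 / (E X\<^sup>2 + E Y\<^sup>2)\<close>. At a minimizing \<open>c\<close> the moment of order \<open>2r - 1\<close> vanishes, and
  Stein's identity for the beta distribution then reduces the moment of order \<open>2r\<close> to the one of
  order \<open>2r - 2\<close> with parameters \<open>\<alpha> + 1\<close> and \<open>\<beta> + 1\<close>. The induction loses only a factor
  \<open>2\<beta> / (\<alpha> + \<beta>) \<ge> 1\<close>, and equality propagates down to \<open>\<alpha> = \<beta>\<close>, \<open>c = 1/2\<close>.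
\<close>

section \<open>Moments of the beta distribution\<close>

text \<open>
  The expectation of \<open>p(B)\<close> for \<open>B\<close> distributed as Beta\<open>(\<alpha>,\<beta>)\<close>, defined algebraically through
  the moments of \<open>B\<close>.
\<close>

definition beta_expect :: "real \<Rightarrow> real \<Rightarrow> real poly \<Rightarrow> real" where
  "beta_expect \<alpha> \<beta> p = (\<Sum>i\<le>degree p. coeff p i * (pochhammer \<alpha> i / pochhammer (\<alpha> + \<beta>) i))"

lemma beta_expect_eq_sum:
  assumes "degree p \<le> n"
  shows "beta_expect \<alpha> \<beta> p = (\<Sum>i\<le>n. coeff p i * (pochhammer \<alpha> i / pochhammer (\<alpha> + \<beta>) i))"
  unfolding beta_expect_def
  by (rule sum.mono_neutral_left) (use assms in \<open>auto simp: coeff_eq_0\<close>)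

lemma beta_expect_add: "beta_expect \<alpha> \<beta> (p + q) = beta_expect \<alpha> \<beta> p + beta_expect \<alpha> \<beta> q"
proof -
  let ?n = "max (degree p) (degree q)"
  have "degree (p + q) \<le> ?n" by (rule degree_add_le_max)
  then show ?thesis
    by (simp add: beta_expect_eq_sum[of _ ?n] sum.distrib algebra_simps add_divide_distrib)
qed

lemma beta_expect_smult: "beta_expect \<alpha> \<beta> (smult c p) = c * beta_expect \<alpha> \<beta> p"
  by (simp add: beta_expect_eq_sum[of "smult c p" "degree p"] degree_smult_le
      beta_expect_def sum_distrib_left mult.assoc)

lemma beta_expect_0 [simp]: "beta_expect \<alpha> \<beta> 0 = 0"
  by (simp add: beta_expect_def)

lemma beta_expect_1 [simp]: "beta_expect \<alpha> \<beta> 1 = 1"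
  by (simp add: beta_expect_def)

lemma beta_expect_monom:
  "beta_expect \<alpha> \<beta> (monom c n) = c * (pochhammer \<alpha> n / pochhammer (\<alpha> + \<beta>) n)"
  by (simp add: beta_expect_eq_sum[of _ n] degree_monom_le if_distrib[of "\<lambda>x. x * _"]
      if_distrib[of "\<lambda>x. x / _"] cong: if_cong)

lemma beta_expect_sum: "beta_expect \<alpha> \<beta> (\<Sum>i\<in>A. f i) = (\<Sum>i\<in>A. beta_expect \<alpha> \<beta> (f i))"
  by (induction A rule: infinite_finite_induct) (auto simp: beta_expect_add)

text \<open>An identity linear in \<open>p\<close> is thereby reduced to monomials, where it becomes
  arithmetic of Pochhammer symbols.\<close>

lemma poly_additive_induct [case_names add monom]:
  fixes p :: "'a::comm_monoid_add poly"
  assumes "\<And>p q. P p \<Longrightarrow> P q \<Longrightarrow> P (p + q)" and "\<And>c n. P (monom c n)"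
  shows "P p"
proof -
  have "P (\<Sum>i\<in>A. monom (coeff p i) i)" if "finite A" for A
    \<comment> \<open>\<open>monom 0 0\<close> is the zero polynomial, which settles the empty
      sum.\<close>
    using that by induction (use assms assms(2)[of 0 0] in auto)
  from this[of "{..degree p}"] show ?thesis
    by (simp add: poly_as_sum_of_monoms)
qed

lemma linear_mult_monom: "[:a, b:] * monom c n = monom (a * c) n + monom (b * c) (Suc n)"
  for a b c :: real
  by (intro poly_eqI)
     (auto simp: coeff_pCons algebra_simps split: nat.split)

text \<open>The factor x turns the Beta(\<alpha>,\<beta>) density into a multiple of the
  Beta(\<alpha>+1,\<beta>) density; on monomials this is (\<alpha>)_(n+1) = \<alpha>
  (\<alpha>+1)_n.\<close>

lemma beta_expect_times_var:
  assumes "0 < \<alpha>" "0 < \<beta>"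
  shows "beta_expect \<alpha> \<beta> ([:0, 1:] * p) = \<alpha> / (\<alpha> + \<beta>) * beta_expect (\<alpha> + 1) \<beta> p"
proof (induction p rule: poly_additive_induct)
  case (add p q)
  then show ?case by (simp only: distrib_left beta_expect_add)
next
  case (monom c n)
  show ?case
    by (simp add: linear_mult_monom beta_expect_monom beta_expect_add pochhammer_rec add_ac del: mult_pCons_left)
qed

lemma beta_expect_times_compl:
  assumes "0 < \<alpha>" "0 < \<beta>"
  shows "beta_expect \<alpha> \<beta> ([:1, -1:] * p) = \<beta> / (\<alpha> + \<beta>) * beta_expect \<alpha> (\<beta> + 1) p"
proof (induction p rule: poly_additive_induct)
  case (add p q)
  then show ?case by (simp only: distrib_left beta_expect_add)
next
  case (monom c n)
  have pos: "pochhammer (\<alpha> + \<beta>) n > 0" "pochhammer (\<alpha> + \<beta> + 1) n > 0"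
    using assms by (simp_all add: pochhammer_pos)
  have rec: "(\<alpha> + \<beta>) * pochhammer (\<alpha> + \<beta> + 1) n = pochhammer (\<alpha> + \<beta>) n * (\<alpha> + \<beta> + n)"
    by (metis pochhammer_rec pochhammer_Suc)
  have "beta_expect \<alpha> \<beta> ([:1, -1:] * monom c n)
      = c * (pochhammer \<alpha> n / pochhammer (\<alpha> + \<beta>) n - pochhammer \<alpha> (Suc n) / pochhammer (\<alpha> + \<beta>) (Suc n))"
    by (simp add: linear_mult_monom beta_expect_monom beta_expect_add right_diff_distrib
        del: mult_pCons_left)
  also have "\<dots> = c * (pochhammer \<alpha> n * \<beta> / (pochhammer (\<alpha> + \<beta>) n * (\<alpha> + \<beta> + n)))"
    using pos assms by (simp add: pochhammer_Suc divide_simps add_pos_nonneg) (simp add: algebra_simps)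
  also have "\<dots> = \<beta> / (\<alpha> + \<beta>) * beta_expect \<alpha> (\<beta> + 1) (monom c n)"
    unfolding rec[symmetric] beta_expect_monom by (simp add: add.assoc)
  finally show ?case .
qed

lemma beta_expect_times_var_compl:
  assumes "0 < \<alpha>" "0 < \<beta>"
  shows "beta_expect \<alpha> \<beta> ([:0, 1:] * ([:1, -1:] * p))
    = \<alpha> * \<beta> / ((\<alpha> + \<beta>) * (\<alpha> + \<beta> + 1)) * beta_expect (\<alpha> + 1) (\<beta> + 1) p"
  using assms by (simp add: beta_expect_times_var beta_expect_times_compl add_ac del: mult_pCons_left)

text \<open>Integration by parts: the derivative of x(1-x) times the beta density is \<alpha> -
  (\<alpha>+\<beta>)x times that density. As the expectation is defined algebraically, the identity
  is checked on monomials.\<close>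

lemma beta_expect_stein:
  assumes "0 < \<alpha>" "0 < \<beta>"
  shows "beta_expect \<alpha> \<beta> ([:0, 1:] * ([:1, -1:] * pderiv p)) = beta_expect \<alpha> \<beta> ([:- \<alpha>, \<alpha> + \<beta>:] * p)"
proof (induction p rule: poly_additive_induct)
  case (add p q)
  then show ?case by (simp only: distrib_left beta_expect_add pderiv_add)
next
  case (monom c n)
  have pos: "pochhammer (\<alpha> + \<beta>) n > 0" "pochhammer (\<alpha> + \<beta>) (Suc n) > 0"
    using assms by (simp_all add: pochhammer_pos)
  have eq: "[:0, 1:] * ([:1, -1:] * pderiv (monom c n)) = monom (n * c) n + monom (- (n * c)) (Suc n)"
    by (cases n) (simp_all add: pderiv_monom linear_mult_monom distrib_left del: mult_pCons_left)
  show ?case unfolding eq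
    using pos assms
    by (simp add: linear_mult_monom beta_expect_monom beta_expect_add pochhammer_Suc divide_simps
        del: mult_pCons_left) (simp add: algebra_simps)
qed

lemma beta_expect_var_power_compl_power:
  assumes "0 < \<alpha>" "0 < \<beta>"
  shows "beta_expect \<alpha> \<beta> ([:0, 1:] ^ i * [:1, -1:] ^ j)
    = pochhammer \<alpha> i * pochhammer \<beta> j / pochhammer (\<alpha> + \<beta>) (i + j)"
  using assms
proof (induction i arbitrary: \<alpha>)
  case 0
  then show ?case
  proof (induction j arbitrary: \<beta>)
    case (Suc j)
    then show ?case
      by (simp add: beta_expect_times_compl pochhammer_rec add_ac del: mult_pCons_left)
  qed simp
next
  case (Suc i)
  then show ?case
    by (simp add: mult.assoc beta_expect_times_var pochhammer_rec add_ac del: mult_pCons_left)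
qed

section \<open>Even moments of a beta variable about a point\<close>

abbreviation beta_moment :: "real \<Rightarrow> real \<Rightarrow> nat \<Rightarrow> real \<Rightarrow> real" where
  "beta_moment \<alpha> \<beta> N c \<equiv> beta_expect \<alpha> \<beta> ([:- c, 1:] ^ N)"

lemma beta_expect_linear: "beta_expect \<alpha> \<beta> [:- c, 1:] = \<alpha> / (\<alpha> + \<beta>) - c"
  by (simp add: beta_expect_def)

text \<open>The factor \<open>q\<close> makes the induction work: splitting x - c into two terms
  moves the x into \<open>q\<close>. For \<open>N = 0\<close> the truncated exponent
  \<open>N - 1\<close> is harmless because of the factor \<open>N\<close>.\<close>

lemma DERIV_beta_expect_mult_power:
  "((\<lambda>c. beta_expect \<alpha> \<beta> (q * [:- c, 1:] ^ N)) has_real_derivative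
    - (real N * beta_expect \<alpha> \<beta> (q * [:- c, 1:] ^ (N - 1)))) (at c)"
proof (induction N arbitrary: q)
  case 0
  then show ?case by simp
next
  case (Suc N)
  have split: "beta_expect \<alpha> \<beta> (q * [:- x, 1:] ^ Suc k)
      = beta_expect \<alpha> \<beta> (q * [:0, 1:] * [:- x, 1:] ^ k) - x * beta_expect \<alpha> \<beta> (q * [:- x, 1:] ^ k)" for x k
  proof -
    have "q * [:- x, 1:] ^ Suc k = q * [:0, 1:] * [:- x, 1:] ^ k + smult (- x) (q * [:- x, 1:] ^ k)"
      by (simp add: algebra_simps)
    then show ?thesis by (simp only: beta_expect_add beta_expect_smult)
  qed
  have "((\<lambda>x. beta_expect \<alpha> \<beta> (q * [:- x, 1:] ^ Suc N)) has_real_derivative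
      - (real N * beta_expect \<alpha> \<beta> (q * [:0, 1:] * [:- c, 1:] ^ (N - 1)))
      - (beta_expect \<alpha> \<beta> (q * [:- c, 1:] ^ N) + c * - (real N * beta_expect \<alpha> \<beta> (q * [:- c, 1:] ^ (N - 1))))) (at c)"
    unfolding split
    by (intro derivative_intros DERIV_cong[OF DERIV_mult[OF DERIV_ident Suc.IH]] Suc.IH) simp
  moreover have "real N * beta_expect \<alpha> \<beta> (q * [:- c, 1:] ^ N)
    = real N * (beta_expect \<alpha> \<beta> (q * [:0, 1:] * [:- c, 1:] ^ (N - 1)) - c * beta_expect \<alpha> \<beta> (q * [:- c, 1:] ^ (N - 1)))"
    using split[of c "N - 1"] by (cases N) simp_all
  ultimately show ?case
    by (elim DERIV_cong) (simp add: ring_distribs del: mult_pCons_left mult_pCons_right)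
qed

lemma DERIV_beta_moment:
  "(beta_moment \<alpha> \<beta> (Suc N) has_real_derivative - (real (Suc N) * beta_moment \<alpha> \<beta> N c)) (at c)"
  using DERIV_beta_expect_mult_power[of \<alpha> \<beta> 1 "Suc N" c] by simp

text \<open>Stein's identity for (x-c)^(N+1): the factor x(1-x) raises both parameters by one, and
  (\<alpha>+\<beta>)x - \<alpha> is re-expanded around \<open>c\<close>.\<close>

lemma beta_moment_rec:
  assumes "0 < \<alpha>" "0 < \<beta>"
  shows "(\<alpha> + \<beta>) * beta_moment \<alpha> \<beta> (Suc (Suc N)) c
    = (\<alpha> - (\<alpha> + \<beta>) * c) * beta_moment \<alpha> \<beta> (Suc N) c
      + real (Suc N) * (\<alpha> * \<beta> / ((\<alpha> + \<beta>) * (\<alpha> + \<beta> + 1))) * beta_moment (\<alpha> + 1) (\<beta> + 1) N c"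
proof -
  have "pderiv ([:- c, 1:] ^ Suc N) = smult (real (Suc N)) ([:- c, 1:] ^ N)"
    by (simp add: pderiv_power_Suc pderiv_pCons del: power_Suc)
  then have "real (Suc N) * beta_expect \<alpha> \<beta> ([:0, 1:] * ([:1, -1:] * [:- c, 1:] ^ N))
      = beta_expect \<alpha> \<beta> ([:- \<alpha>, \<alpha> + \<beta>:] * [:- c, 1:] ^ Suc N)"
    using beta_expect_stein[OF assms, of "[:- c, 1:] ^ Suc N"]
    by (simp only: mult_smult_right beta_expect_smult)
  also have "[:- \<alpha>, \<alpha> + \<beta>:] * [:- c, 1:] ^ Suc N
      = smult (\<alpha> + \<beta>) ([:- c, 1:] ^ Suc (Suc N)) + smult ((\<alpha> + \<beta>) * c - \<alpha>) ([:- c, 1:] ^ Suc N)"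
  proof -
    have "[:- \<alpha>, \<alpha> + \<beta>:] = smult (\<alpha> + \<beta>) [:- c, 1:] + [:(\<alpha> + \<beta>) * c - \<alpha>:]" by simp
    then have "[:- \<alpha>, \<alpha> + \<beta>:] * q = smult (\<alpha> + \<beta>) ([:- c, 1:] * q) + smult ((\<alpha> + \<beta>) * c - \<alpha>) q" for q
      by (simp only: distrib_right mult_smult_left) simp
    then show ?thesis by (simp only: power_Suc)
  qed
  finally show ?thesis
    by (simp add: beta_expect_times_var_compl[OF assms] beta_expect_add beta_expect_smult algebra_simps
        del: mult_pCons_left power_Suc)
qed

section \<open>Minimization over the center and the resulting lower bound\<close>

lemma beta_moment_0_pos:
  assumes "0 < \<alpha>" "0 < \<beta>"
  shows "beta_moment \<alpha> \<beta> N 0 > 0"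
  using beta_expect_var_power_compl_power[OF assms, of N 0] assms
  by (simp add: pochhammer_pos)

lemma beta_moment_1_neg:
  assumes "0 < \<alpha>" "0 < \<beta>" "odd N"
  shows "beta_moment \<alpha> \<beta> N 1 < 0"
proof -
  have "[:- 1, 1:] ^ N = smult (- 1) ([:1, -1:] ^ N :: real poly)"
  proof -
    have "[:- 1, 1:] = - [:1, -1 :: real:]" by simp
    then show ?thesis using \<open>odd N\<close> power_minus_odd[of N "[:1, -1 :: real:]"] by simp
  qed
  then have "beta_moment \<alpha> \<beta> N 1 = - beta_expect \<alpha> \<beta> ([:1, -1:] ^ N)"
    by (simp only: beta_expect_smult)
  then show ?thesis
    using beta_expect_var_power_compl_power[OF assms(1,2), of 0 N] assms
    by (simp add: pochhammer_pos)
qed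

text \<open>The derivative of the moment of order N+1 is -(N+1) times the moment of order
  \<open>N\<close>. It is negative at 0 and positive at 1, so a minimizer over [0,1] is interior and
  the derivative vanishes there.\<close>

lemma beta_moment_minimizer_critical:
  assumes "0 < \<alpha>" "0 < \<beta>" "odd N" "c \<in> {0..1}"
    and min: "\<And>x. x \<in> {0..1} \<Longrightarrow> beta_moment \<alpha> \<beta> (Suc N) c \<le> beta_moment \<alpha> \<beta> (Suc N) x"
  shows "beta_moment \<alpha> \<beta> N c = 0"
proof -
  note D = DERIV_beta_moment[of \<alpha> \<beta> N]
  have "c \<noteq> 0"
  proof
    assume "c = 0"
    have "- (real (Suc N) * beta_moment \<alpha> \<beta> N 0) < 0"
      using beta_moment_0_pos[OF assms(1,2)] by simp
    from DERIV_neg_dec_right[OF D this] obtain d where d: "d > 0"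
      "\<And>h. 0 < h \<Longrightarrow> h < d \<Longrightarrow> beta_moment \<alpha> \<beta> (Suc N) (0 + h) < beta_moment \<alpha> \<beta> (Suc N) 0"
      by blast
    \<comment> \<open>The increment \<open>min (d/2) 1\<close> stays below \<open>d\<close> and
      keeps the point inside [0,1].\<close>
    from d(2)[of "min (d/2) 1"] min[of "min (d/2) 1"] \<open>c = 0\<close> d(1) show False
      by (auto simp: min_less_iff_disj simp del: power_Suc)
  qed
  moreover have "c \<noteq> 1"
  proof
    assume "c = 1"
    have "0 < - (real (Suc N) * beta_moment \<alpha> \<beta> N 1)"
      using beta_moment_1_neg[OF assms(1-3)] by (simp add: mult_less_0_iff)
    from DERIV_pos_inc_left[OF D this] obtain d where d: "d > 0"
      "\<And>h. 0 < h \<Longrightarrow> h < d \<Longrightarrow> beta_moment \<alpha> \<beta> (Suc N) (1 - h) < beta_moment \<alpha> \<beta> (Suc N) 1"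
      by blast
    from d(2)[of "min (d/2) 1"] min[of "1 - min (d/2) 1"] \<open>c = 1\<close> d(1) show False
      by (auto simp: min_less_iff_disj simp del: power_Suc)
  qed
  ultimately have c: "0 < c" "c < 1" using assms(4) by auto
  have "- (real (Suc N) * beta_moment \<alpha> \<beta> N c) = 0"
  proof (rule DERIV_local_min[OF D])
    show "0 < min c (1 - c)" using c by simp
    show "\<forall>y. \<bar>c - y\<bar> < min c (1 - c) \<longrightarrow> beta_moment \<alpha> \<beta> (Suc N) c \<le> beta_moment \<alpha> \<beta> (Suc N) y"
      by (intro allI impI min) auto
  qed
  then show ?thesis by simp
qed

text \<open>For \<alpha> = \<beta> this is the moment of order 2r about 1/2. In general only
  \<alpha>, the smaller parameter where the bound is applied, enters the numerator.\<close>

definition beta_bound :: "real \<Rightarrow> real \<Rightarrow> nat \<Rightarrow> real" where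
  "beta_bound \<alpha> \<beta> r = pochhammer (1/2) r * pochhammer \<alpha> r / pochhammer (\<alpha> + \<beta>) (2 * r)"

text \<open>This mirrors the recursion of the moments at a critical center, with 2\<beta> in place
  of \<alpha>+\<beta>; the 2 comes from 2 (1/2)_(r+1) = (2r+1) (1/2)_r.\<close>

lemma beta_bound_Suc:
  assumes "0 < \<alpha>" "0 < \<beta>"
  shows "real (Suc (2 * r)) * (\<alpha> * \<beta> / ((\<alpha> + \<beta>) * (\<alpha> + \<beta> + 1))) * beta_bound (\<alpha> + 1) (\<beta> + 1) r
    = 2 * \<beta> * beta_bound \<alpha> \<beta> (Suc r)"
proof -
  have "pochhammer (\<alpha> + \<beta>) (2 * Suc r)
      = (\<alpha> + \<beta>) * (\<alpha> + \<beta> + 1) * pochhammer (\<alpha> + 1 + (\<beta> + 1)) (2 * r)"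
    by (simp add: pochhammer_rec add_ac)
  moreover have "2 * pochhammer (1/2::real) (Suc r) = real (Suc (2 * r)) * pochhammer (1/2) r"
    by (simp add: pochhammer_Suc field_simps)
  moreover have "pochhammer \<alpha> (Suc r) = \<alpha> * pochhammer (\<alpha> + 1) r"
    by (simp add: pochhammer_rec)
  moreover have "2 * \<beta> * beta_bound \<alpha> \<beta> (Suc r)
      = \<beta> * (2 * pochhammer (1/2) (Suc r)) * pochhammer \<alpha> (Suc r) / pochhammer (\<alpha> + \<beta>) (2 * Suc r)"
    by (simp add: beta_bound_def)
  ultimately show ?thesis
    by (simp add: beta_bound_def)
qed

lemma beta_bound_pos:
  assumes "0 < \<alpha>" "0 < \<beta>"
  shows "beta_bound \<alpha> \<beta> r > 0"
  using assms by (simp add: beta_bound_def pochhammer_pos)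

text \<open>Induction on \<open>r\<close> with \<alpha>, \<beta> and \<open>c\<close> free, since
  the recursion raises both parameters and preserves \<alpha> \<le> \<beta>. The equality clause
  starts at r = 1 because for r = 0 both sides are always 1.\<close>

lemma beta_moment_ge_bound:
  assumes "0 < \<alpha>" "\<alpha> \<le> \<beta>" "c \<in> {0..1}"
  shows "beta_moment \<alpha> \<beta> (2 * r) c \<ge> beta_bound \<alpha> \<beta> r \<and>
    (r \<ge> 1 \<longrightarrow> beta_moment \<alpha> \<beta> (2 * r) c = beta_bound \<alpha> \<beta> r \<longrightarrow> \<alpha> = \<beta> \<and> c = 1/2)"
  using assms
proof (induction r arbitrary: \<alpha> \<beta> c)
  case 0
  then show ?case by (simp add: beta_bound_def)
next
  case (Suc r)
  define K where "K = \<alpha> * \<beta> / ((\<alpha> + \<beta>) * (\<alpha> + \<beta> + 1))"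
  let ?g = "beta_moment \<alpha> \<beta> (2 * Suc r)" and ?h = "beta_moment (\<alpha> + 1) (\<beta> + 1) (2 * r)"
  have pos: "0 < \<alpha>" "0 < \<beta>" and "0 < K" using Suc.prems by (auto simp: K_def)
  have B: "beta_bound \<alpha> \<beta> (Suc r) > 0" using pos by (rule beta_bound_pos)
  have K: "real (Suc (2 * r)) * K * beta_bound (\<alpha> + 1) (\<beta> + 1) r = 2 * \<beta> * beta_bound \<alpha> \<beta> (Suc r)"
    unfolding K_def using pos by (rule beta_bound_Suc)
  have g: "(\<alpha> + \<beta>) * ?g x = real (Suc (2 * r)) * K * ?h x"
    and crit: "beta_moment \<alpha> \<beta> (Suc (2 * r)) x = 0"
    if "x \<in> {0..1}" "\<And>y. y \<in> {0..1} \<Longrightarrow> ?g x \<le> ?g y" for x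
  proof -
    show crit: "beta_moment \<alpha> \<beta> (Suc (2 * r)) x = 0"
      by (rule beta_moment_minimizer_critical[OF pos _ that(1)]) (use that(2) in auto)
    show "(\<alpha> + \<beta>) * ?g x = real (Suc (2 * r)) * K * ?h x"
      using beta_moment_rec[OF pos, where N = "2 * r" and c = x] crit by (simp add: K_def del: power_Suc)
  qed
  have IH: "?h x \<ge> beta_bound (\<alpha> + 1) (\<beta> + 1) r \<and>
      (r \<ge> 1 \<longrightarrow> ?h x = beta_bound (\<alpha> + 1) (\<beta> + 1) r \<longrightarrow> \<alpha> + 1 = \<beta> + 1 \<and> x = 1/2)"
    if "x \<in> {0..1}" for x
    using Suc.IH[of "\<alpha> + 1" "\<beta> + 1" x] Suc.prems that by auto
  \<comment> \<open>The first inequality is \<alpha>+\<beta> \<le> 2\<beta>; the second inserts the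
    induction hypothesis into the recursion at a minimizer.\<close>
  have chain: "(\<alpha> + \<beta>) * beta_bound \<alpha> \<beta> (Suc r) \<le> 2 * \<beta> * beta_bound \<alpha> \<beta> (Suc r)"
    "2 * \<beta> * beta_bound \<alpha> \<beta> (Suc r) \<le> (\<alpha> + \<beta>) * ?g x"
    if "x \<in> {0..1}" "\<And>y. y \<in> {0..1} \<Longrightarrow> ?g x \<le> ?g y" for x
  proof -
    show "(\<alpha> + \<beta>) * beta_bound \<alpha> \<beta> (Suc r) \<le> 2 * \<beta> * beta_bound \<alpha> \<beta> (Suc r)"
      using B Suc.prems by (intro mult_right_mono) auto
    have "2 * \<beta> * beta_bound \<alpha> \<beta> (Suc r) \<le> real (Suc (2 * r)) * K * ?h x"
      unfolding K[symmetric] using IH[OF that(1)] \<open>0 < K\<close> by (intro mult_left_mono) auto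
    also have "\<dots> = (\<alpha> + \<beta>) * ?g x" by (rule g[symmetric]) (fact that)+
    finally show "2 * \<beta> * beta_bound \<alpha> \<beta> (Suc r) \<le> (\<alpha> + \<beta>) * ?g x" .
  qed
  \<comment> \<open>Compactness provides a minimizer, and the bound there covers all of
    [0,1].\<close>
  have "continuous_on {0..1} ?g"
    using DERIV_beta_moment[of \<alpha> \<beta> "Suc (2 * r)"]
    by (auto intro!: DERIV_continuous_on intro: has_field_derivative_at_within simp del: power_Suc)
  then obtain x where x: "x \<in> {0..1}" "\<And>y. y \<in> {0..1} \<Longrightarrow> ?g x \<le> ?g y"
    using continuous_attains_inf[of "{0..1::real}" ?g] by auto
  have "(\<alpha> + \<beta>) * beta_bound \<alpha> \<beta> (Suc r) \<le> (\<alpha> + \<beta>) * ?g x"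
    using chain[OF x] by linarith
  then have ge_x: "beta_bound \<alpha> \<beta> (Suc r) \<le> ?g x"
    using pos by (simp del: power_Suc)
  have ge: "beta_bound \<alpha> \<beta> (Suc r) \<le> ?g y" if "y \<in> {0..1}" for y
    using ge_x x(2)[OF that] by linarith
  moreover have "\<alpha> = \<beta> \<and> c = 1/2" if eq: "?g c = beta_bound \<alpha> \<beta> (Suc r)"
  proof -
    \<comment> \<open>A center attaining the bound is itself a minimizer, so \<open>chain\<close>
      applies to \<open>c\<close> and its inequalities become equalities.\<close>
    have c: "c \<in> {0..1}" "\<And>y. y \<in> {0..1} \<Longrightarrow> ?g c \<le> ?g y"
      using Suc.prems ge eq by auto
    have ab: "2 * \<beta> * beta_bound \<alpha> \<beta> (Suc r) = (\<alpha> + \<beta>) * beta_bound \<alpha> \<beta> (Suc r)"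
      using chain[OF c] unfolding eq by linarith
    then have "\<alpha> = \<beta>" using B by simp
    \<comment> \<open>For r \<ge> 1 the center comes from the equality clause of the induction
      hypothesis; for r = 0 it comes from the vanishing first moment, that is, c =
      \<alpha>/(\<alpha>+\<beta>).\<close>
    moreover have "c = 1/2"
    proof (cases "r \<ge> 1")
      case True
      have "real (Suc (2 * r)) * K * ?h c = real (Suc (2 * r)) * K * beta_bound (\<alpha> + 1) (\<beta> + 1) r"
        using g[OF c] K ab eq by metis
      then have "?h c = beta_bound (\<alpha> + 1) (\<beta> + 1) r" using \<open>0 < K\<close> by simp
      then show ?thesis using IH[OF c(1)] True by blast
    next
      case False
      then have "r = 0" by simp
      then show ?thesis
        using crit[OF c] \<open>\<alpha> = \<beta>\<close> pos by (simp add: beta_expect_linear field_simps)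
    qed
    ultimately show ?thesis ..
  qed
  ultimately show ?case using Suc.prems by blast
qed

text \<open>With equal parameters and center 1/2 the middle term of \<open>beta_moment_rec\<close>
  is zero and 2\<beta> = \<alpha>+\<beta>, so moment and bound obey the same recursion.\<close>

lemma beta_moment_symmetric_half:
  assumes "0 < \<alpha>"
  shows "beta_moment \<alpha> \<alpha> (2 * r) (1/2) = beta_bound \<alpha> \<alpha> r"
  using assms
proof (induction r arbitrary: \<alpha>)
  case 0
  then show ?case by (simp add: beta_bound_def)
next
  case (Suc r)
  have "(\<alpha> + \<alpha>) * beta_moment \<alpha> \<alpha> (2 * Suc r) (1/2) = 2 * \<alpha> * beta_bound \<alpha> \<alpha> (Suc r)"
    using beta_moment_rec[OF Suc.prems Suc.prems, where N = "2 * r" and c = "1/2"] Suc.IH[of "\<alpha> + 1"] Suc.prems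
    by (simp add: beta_bound_Suc[OF Suc.prems Suc.prems, symmetric] del: power_Suc)
  then show ?case using Suc.prems by (simp del: power_Suc)
qed

section \<open>The inequality for even moments of Gaussian variables\<close>

text \<open>For a beta variable B, (a+b)(B - b/(a+b)) = aB - b(1-B); expand the N-th power and
  insert the mixed moments of B and 1-B. The factor \<open>pochhammer (\<alpha> + \<beta>) N\<close>
  is the N-th moment of the gamma total and clears the common denominator.\<close>

lemma alternating_sum_eq_beta_moment:
  assumes "0 < \<alpha>" "0 < \<beta>" "0 < a" "0 < b"
  shows "(\<Sum>k\<le>N. real (N choose k) * (- b) ^ k * a ^ (N - k) * (pochhammer \<alpha> (N - k) * pochhammer \<beta> k))
    = pochhammer (\<alpha> + \<beta>) N * (a + b) ^ N * beta_moment \<alpha> \<beta> N (b / (a + b))"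
proof -
  let ?x = "[:0, 1:] :: real poly" and ?y = "[:1, -1:] :: real poly"
  have "smult (a + b) [:- (b / (a + b)), 1:] = smult (- b) ?y + smult a ?x"
    using assms by (simp add: field_simps)
  then have "smult ((a + b) ^ N) ([:- (b / (a + b)), 1:] ^ N) = (smult (- b) ?y + smult a ?x) ^ N"
    by (metis smult_power)
  also have "\<dots> = (\<Sum>k\<le>N. smult (real (N choose k) * (- b) ^ k * a ^ (N - k)) (?x ^ (N - k) * ?y ^ k))"
    unfolding binomial_ring by (intro sum.cong refl)
      (simp only: smult_power of_nat_mult_conv_smult mult_smult_left mult_smult_right smult_smult mult_ac)
  finally have "(a + b) ^ N * beta_moment \<alpha> \<beta> N (b / (a + b))
      = (\<Sum>k\<le>N. real (N choose k) * (- b) ^ k * a ^ (N - k) *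
          (pochhammer \<alpha> (N - k) * pochhammer \<beta> k / pochhammer (\<alpha> + \<beta>) N))"
    by (simp add: beta_expect_smult[symmetric] beta_expect_sum)
       (simp add: beta_expect_smult beta_expect_var_power_compl_power[OF assms(1,2)])
  moreover have "pochhammer (\<alpha> + \<beta>) N > 0" using assms by (simp add: pochhammer_pos)
  ultimately show ?thesis
    by (simp add: sum_distrib_left mult.assoc)
qed

text \<open>A positive factor carries over the bound and its equality case; the center b/(a+b) is
  1/2 exactly when a = b.\<close>

lemma alternating_sum_ge:
  assumes "0 < \<alpha>" "\<alpha> \<le> \<beta>" "0 < a" "0 < b" "r \<ge> 1"
  defines "S \<equiv> \<Sum>k\<le>2*r. real (2*r choose k) * (- b) ^ k * a ^ (2*r - k) *
    (pochhammer \<alpha> (2*r - k) * pochhammer \<beta> k)"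
    and "T \<equiv> pochhammer (1/2) r * pochhammer \<alpha> r * (a + b) ^ (2*r)"
  shows "S \<ge> T" "S = T \<longleftrightarrow> \<alpha> = \<beta> \<and> a = b"
proof -
  let ?C = "pochhammer (\<alpha> + \<beta>) (2*r) * (a + b) ^ (2*r)" and ?c = "b / (a + b)"
  have "0 < \<beta>" using assms by simp
  have C: "?C > 0" using assms by (simp add: pochhammer_pos)
  have S: "S = ?C * beta_moment \<alpha> \<beta> (2*r) ?c"
    unfolding S_def using assms \<open>0 < \<beta>\<close> by (simp add: alternating_sum_eq_beta_moment)
  have "pochhammer (\<alpha> + \<beta>) (2*r) > 0" using assms by (simp add: pochhammer_pos)
  then have T: "T = ?C * beta_bound \<alpha> \<beta> r"
    unfolding T_def beta_bound_def by simp
  have c: "?c \<in> {0..1}" using assms by simp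
  note bound = beta_moment_ge_bound[OF assms(1,2) c, of r]
  show "S \<ge> T" unfolding S T using C bound by (intro mult_left_mono) auto
  have half: "?c = 1/2 \<longleftrightarrow> a = b" using assms by (auto simp: field_simps)
  have "S = T \<longleftrightarrow> beta_moment \<alpha> \<beta> (2*r) ?c = beta_bound \<alpha> \<beta> r"
    unfolding S T using less_imp_neq[OF C] by (metis mult_cancel_left)
  also have "\<dots> \<longleftrightarrow> \<alpha> = \<beta> \<and> ?c = 1/2"
  proof
    assume "\<alpha> = \<beta> \<and> ?c = 1/2"
    then show "beta_moment \<alpha> \<beta> (2*r) ?c = beta_bound \<alpha> \<beta> r"
      using beta_moment_symmetric_half[OF assms(1), of r] by (simp only:)
  qed (use bound \<open>r \<ge> 1\<close> in blast)
  finally show "S = T \<longleftrightarrow> \<alpha> = \<beta> \<and> a = b" unfolding half .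
qed

section \<open>Moments of independent centered Gaussian variables\<close>

context prob_space
begin

lemma centered_normal_integrable_power:
  assumes "0 < \<sigma>" "distributed M lborel X (normal_density 0 \<sigma>)"
  shows "integrable M (\<lambda>w. X w ^ k)"
  using integrable_normal_moment[OF assms(1), of 0 k]
  by (subst distributed_integrable[OF assms(2), symmetric]) auto

text \<open>The usual factor (2k)!/(2^k k!) is rewritten by (2k)! = 4^k k! (1/2)_k, so that
  Pochhammer shifts apply.\<close>

lemma centered_normal_even_moment:
  assumes "0 < \<sigma>" "distributed M lborel X (normal_density 0 \<sigma>)"
  shows "expectation (\<lambda>w. X w ^ (2 * k)) = (2 * \<sigma>\<^sup>2) ^ k * pochhammer (1/2) k"
proof -
  have "expectation (\<lambda>w. X w ^ (2 * k)) = fact (2 * k) / ((2 / \<sigma>\<^sup>2) ^ k * fact k)"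
    using integral_normal_moment_even[OF assms(1), of 0 k]
    by (subst distributed_integral[OF assms(2), symmetric]) auto
  also have "\<dots> = (2 * \<sigma>\<^sup>2) ^ k * pochhammer (1/2) k"
    using assms(1)
    by (simp add: fact_double power_divide power_mult_distrib power_mult[symmetric] divide_simps)
       (simp add: power_mult power_mult_distrib[symmetric])
  finally show ?thesis .
qed

lemma indep_set_commute: "indep_set A B \<Longrightarrow> indep_set B A"
  unfolding indep_sets2_eq by (metis Int_commute mult.commute)

lemma indep_power_product:
  fixes X Y :: "'a \<Rightarrow> real"
  assumes "indep_var borel X borel Y" "integrable M (\<lambda>w. X w ^ i)" "integrable M (\<lambda>w. Y w ^ j)"
  shows "integrable M (\<lambda>w. X w ^ i * Y w ^ j)"
    and "expectation (\<lambda>w. X w ^ i * Y w ^ j) = expectation (\<lambda>w. X w ^ i) * expectation (\<lambda>w. Y w ^ j)"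
proof -
  have "indep_var borel ((\<lambda>x. x ^ i) \<circ> X) borel ((\<lambda>x. x ^ j) \<circ> Y)"
    by (rule indep_var_compose[OF assms(1)]) auto
  then have "indep_var borel (\<lambda>w. X w ^ i) borel (\<lambda>w. Y w ^ j)" by (simp add: comp_def)
  then show "integrable M (\<lambda>w. X w ^ i * Y w ^ j)"
    and "expectation (\<lambda>w. X w ^ i * Y w ^ j) = expectation (\<lambda>w. X w ^ i) * expectation (\<lambda>w. Y w ^ j)"
    using assms(2,3) by (auto intro: indep_var_integrable indep_var_lebesgue_integral)
qed

text \<open>Binomial expansion and independence leave products of even moments, and (1/2)_(m+j) =
  (1/2)_m (1/2+m)_j splits off the moments of X^(2m) and Y^(2n). What remains is the alternating sum
  with \<alpha> = m + 1/2 and \<beta> = n + 1/2.\<close>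

lemma gaussian_mixed_moment:
  assumes "0 < \<sigma>" "distributed M lborel X (normal_density 0 \<sigma>)"
    and "0 < \<tau>" "distributed M lborel Y (normal_density 0 \<tau>)"
    and "indep_var borel X borel Y"
  shows "expectation (\<lambda>w. X w ^ (2*m) * Y w ^ (2*n) * ((X w)\<^sup>2 - (Y w)\<^sup>2) ^ N)
    = expectation (\<lambda>w. X w ^ (2*m)) * expectation (\<lambda>w. Y w ^ (2*n)) * 2 ^ N *
      (\<Sum>k\<le>N. real (N choose k) * (- \<tau>\<^sup>2) ^ k * (\<sigma>\<^sup>2) ^ (N - k) *
        (pochhammer (1/2 + m) (N - k) * pochhammer (1/2 + n) k))"
proof -
  have expand: "x ^ (2*m) * y ^ (2*n) * (x\<^sup>2 - y\<^sup>2) ^ N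
      = (\<Sum>k\<le>N. real (N choose k) * (- 1) ^ k * (x ^ (2 * (m + (N - k))) * y ^ (2 * (n + k))))" for x y :: real
  proof -
    have "(x\<^sup>2 - y\<^sup>2) ^ N = (- y\<^sup>2 + x\<^sup>2) ^ N" by simp
    also have "\<dots> = (\<Sum>k\<le>N. real (N choose k) * (- y\<^sup>2) ^ k * (x\<^sup>2) ^ (N - k))" by (rule binomial_ring)
    finally have "x ^ (2*m) * y ^ (2*n) * (x\<^sup>2 - y\<^sup>2) ^ N
      = x ^ (2*m) * y ^ (2*n) * (\<Sum>k\<le>N. real (N choose k) * (- y\<^sup>2) ^ k * (x\<^sup>2) ^ (N - k))" by simp
    also have "\<dots> = (\<Sum>k\<le>N. real (N choose k) * (- 1) ^ k * (x ^ (2 * (m + (N - k))) * y ^ (2 * (n + k))))"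
      unfolding sum_distrib_left
      by (intro sum.cong refl, subst power_minus)
         (simp only: power_mult[symmetric] power_add distrib_left distrib_right mult_ac)
    finally show ?thesis .
  qed
  note int = centered_normal_integrable_power[OF assms(1,2)] centered_normal_integrable_power[OF assms(3,4)]
  note prod = indep_power_product[OF assms(5) int]
  have "expectation (\<lambda>w. X w ^ (2*m) * Y w ^ (2*n) * ((X w)\<^sup>2 - (Y w)\<^sup>2) ^ N)
    = (\<Sum>k\<le>N. real (N choose k) * (- 1) ^ k *
        (expectation (\<lambda>w. X w ^ (2 * (m + (N - k)))) * expectation (\<lambda>w. Y w ^ (2 * (n + k)))))"
    unfolding expand using prod by (subst Bochner_Integration.integral_sum) auto
  also have "\<dots> = (\<Sum>k\<le>N. expectation (\<lambda>w. X w ^ (2*m)) * expectation (\<lambda>w. Y w ^ (2*n)) * 2 ^ N *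
      (real (N choose k) * (- \<tau>\<^sup>2) ^ k * (\<sigma>\<^sup>2) ^ (N - k) *
        (pochhammer (1/2 + m) (N - k) * pochhammer (1/2 + n) k)))"
  proof (intro sum.cong refl)
    fix k assume "k \<in> {..N}"
    \<comment> \<open>The two moments contribute 2^(N-k) and 2^k, whose product does not depend on
      \<open>k\<close>.\<close>
    then have "(2::real) ^ N = 2 ^ (N - k) * 2 ^ k" by (simp flip: power_add)
    then show "real (N choose k) * (- 1) ^ k *
        (expectation (\<lambda>w. X w ^ (2 * (m + (N - k)))) * expectation (\<lambda>w. Y w ^ (2 * (n + k))))
      = expectation (\<lambda>w. X w ^ (2*m)) * expectation (\<lambda>w. Y w ^ (2*n)) * 2 ^ N *
      (real (N choose k) * (- \<tau>\<^sup>2) ^ k * (\<sigma>\<^sup>2) ^ (N - k) *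
        (pochhammer (1/2 + m) (N - k) * pochhammer (1/2 + n) k))"
      unfolding centered_normal_even_moment[OF assms(1,2)] centered_normal_even_moment[OF assms(3,4)]
      by (subst (2) power_minus) (simp add: pochhammer_product' power_add power_mult_distrib mult_ac)
  qed
  finally show ?thesis by (simp add: sum_distrib_left)
qed

lemma gaussian_product_inequality:
  assumes "0 < \<sigma>" and X: "distributed M lborel X (normal_density 0 \<sigma>)"
    and "0 < \<tau>" and Y: "distributed M lborel Y (normal_density 0 \<tau>)"
    and indep: "indep_var borel X borel Y"
    and "r \<ge> 1" "m \<le> n"
  defines "lhs \<equiv> expectation (\<lambda>w. X w ^ (2*m) * Y w ^ (2*n) * ((X w)\<^sup>2 - (Y w)\<^sup>2) ^ (2*r))"
    and "rhs \<equiv> half_binomial (m + r) r * expectation (\<lambda>w. X w ^ (2*m)) * expectation (\<lambda>w. Y w ^ (2*n))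
      * (expectation (\<lambda>w. (X w + Y w) ^ (2*r)))\<^sup>2"
  shows "lhs \<ge> rhs \<and> (lhs = rhs \<longleftrightarrow> m = n \<and> \<sigma>\<^sup>2 = \<tau>\<^sup>2)"
proof -
  \<comment> \<open>\<open>C\<close> is the positive factor common to both sides; on the right,
    2^(2r) arises from squaring the 2^r in the moment of X + Y.\<close>
  define C where "C = expectation (\<lambda>w. X w ^ (2*m)) * expectation (\<lambda>w. Y w ^ (2*n)) * 2 ^ (2*r)"
  have "C > 0"
    unfolding C_def centered_normal_even_moment[OF assms(1) X] centered_normal_even_moment[OF assms(3) Y]
    using assms(1,3) by (simp add: pochhammer_pos)
  let ?S = "\<Sum>k\<le>2*r. real (2*r choose k) * (- \<tau>\<^sup>2) ^ k * (\<sigma>\<^sup>2) ^ (2*r - k) *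
        (pochhammer (1/2 + m) (2*r - k) * pochhammer (1/2 + n) k)"
  let ?T = "pochhammer (1/2) r * pochhammer (1/2 + m) r * (\<sigma>\<^sup>2 + \<tau>\<^sup>2) ^ (2*r)"
  have lhs: "lhs = C * ?S"
    unfolding lhs_def C_def by (rule gaussian_mixed_moment[OF assms(1) X assms(3) Y indep])
  have "distributed M lborel (\<lambda>w. X w + Y w) (normal_density 0 (sqrt (\<sigma>\<^sup>2 + \<tau>\<^sup>2)))"
    using add_indep_normal[OF indep assms(1,3) X Y] by simp
  from centered_normal_even_moment[OF _ this]
  have XY: "expectation (\<lambda>w. (X w + Y w) ^ (2*r)) = 2 ^ r * (\<sigma>\<^sup>2 + \<tau>\<^sup>2) ^ r * pochhammer (1/2) r"
    using assms(1,3) unfolding power_mult_distrib by (simp add: add_pos_pos)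
  \<comment> \<open>One factor (1/2)_r cancels against the half binomial, and the remaining quotient
    (1/2)_(m+r)/(1/2)_m is (1/2+m)_r.\<close>
  have half: "half_binomial (m + r) r * (pochhammer (1/2) r)\<^sup>2 = pochhammer (1/2) r * pochhammer (1/2 + m) r"
    using pochhammer_pos[of "1/2::real" m] pochhammer_pos[of "1/2::real" r]
    by (simp add: half_binomial_def pochhammer_product'[of _ m r] power2_eq_square)
  have "rhs = C * (half_binomial (m + r) r * (pochhammer (1/2) r)\<^sup>2 * (\<sigma>\<^sup>2 + \<tau>\<^sup>2) ^ (2*r))"
    unfolding rhs_def XY C_def
    by (simp add: power_mult_distrib power_mult[symmetric] mult_ac)
  then have rhs: "rhs = C * ?T" unfolding half .
  have ge: "?S \<ge> ?T" and eq: "?S = ?T \<longleftrightarrow> 1/2 + real m = 1/2 + real n \<and> \<sigma>\<^sup>2 = \<tau>\<^sup>2"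
    by (rule alternating_sum_ge; use assms in simp)+
  show ?thesis
    unfolding lhs rhs using \<open>C > 0\<close> ge eq by simp
qed

end

theorem theorem2p2:
  fixes M :: "'a measure" and X Y :: "'a \<Rightarrow> real" and \<sigma> \<tau> :: real and r m n :: nat
  assumes "prob_space M"
    and "\<sigma> > 0" and "distributed M lborel X (normal_density 0 \<sigma>)"
    and "\<tau> > 0" and "distributed M lborel Y (normal_density 0 \<tau>)"
    and "prob_space.indep_var M borel X borel Y"
    and "r \<ge> 1"
  defines "lhs \<equiv> prob_space.expectation M
      (\<lambda>w. X w ^ (2*m) * Y w ^ (2*n) * ((X w)\<^sup>2 - (Y w)\<^sup>2) ^ (2*r))"
    and "rhs \<equiv> half_binomial (min m n + r) r
      * prob_space.expectation M (\<lambda>w. X w ^ (2*m))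
      * prob_space.expectation M (\<lambda>w. Y w ^ (2*n))
      * (prob_space.expectation M (\<lambda>w. (X w + Y w) ^ (2*r)))\<^sup>2"
  shows "lhs \<ge> rhs \<and>
    (lhs = rhs \<longleftrightarrow> m = n \<and>
      prob_space.expectation M (\<lambda>w. (X w)\<^sup>2) = prob_space.expectation M (\<lambda>w. (Y w)\<^sup>2))"
proof -
  interpret prob_space M by fact
  note X = assms(2,3) and Y = assms(4,5)
  have var: "expectation (\<lambda>w. (X w)\<^sup>2) = \<sigma>\<^sup>2" "expectation (\<lambda>w. (Y w)\<^sup>2) = \<tau>\<^sup>2"
    using centered_normal_even_moment[OF X, of 1] centered_normal_even_moment[OF Y, of 1] by simp_all
  show ?thesis
  proof (cases "m \<le> n")
    case True
    then show ?thesis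
      using gaussian_product_inequality[OF X Y assms(6,7) True]
      unfolding lhs_def rhs_def var by (simp add: min_absorb1)
  next
    case False
    \<comment> \<open>For m > n the roles of X and Y are exchanged; the even exponent 2r makes the
      power of X^2 - Y^2 symmetric.\<close>
    have indep: "indep_var borel Y borel X"
      using assms(6) unfolding indep_var_eq by (blast intro: indep_set_commute)
    have swap: "y ^ (2*n) * x ^ (2*m) * (y\<^sup>2 - x\<^sup>2) ^ (2*r) = x ^ (2*m) * y ^ (2*n) * (x\<^sup>2 - y\<^sup>2) ^ (2*r)"
      for x y :: real
    proof -
      have "(y\<^sup>2 - x\<^sup>2) ^ (2*r) = (x\<^sup>2 - y\<^sup>2) ^ (2*r)" by (metis power_mult power2_commute)
      then show ?thesis by (simp only: mult_ac)
    qed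
    show ?thesis
      using gaussian_product_inequality[OF Y X indep assms(7), of n m] False
      unfolding lhs_def rhs_def var swap by (auto simp: min_absorb2 mult_ac add.commute)
  qed
qed

end
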